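(* Let $m, r$ and $d$ be integers such that $d \geq 1$ and $2 \leq 2r \leq m-1$. If $d_1, d_2, \ldots, d_r$ are any integers such that $d\ge d_i\ge d/2$ for $i=1,\ldots,r$, then $$ \mathcal{A}(d_1,\ldots,d_r)\subseteq \overline{\mathcal{A}\left(\left\lceil \tfrac{d}{2}\right\rceil,\ldots,\left\lceil \tfrac{d}{2}\right\rceil\right)}, $$ where $\lceil d/2\rceil$ appears $r$ times as an argument of $\mathcal{A}$ on the right-hand side.
   Context: All matrix polynomials have coefficients in $\mathbb{C}$. $\mathrm{POL}^{p\times q}$ is the set of all $p\times q$ matrix polynomials. $\Delta_r$ is the $r\times r$ matrix with ones on the anti-diagonal and zeros elsewhere. $L_{*i}$ denotes the $i$-th column of $L(\lambda)$; the degree of a vector polynomial is the largest power of $\lambda$ with a nonzero vector coefficient (so a vector polynomial whose degree is a nonnegative integer is nonzero). For integers $d_1,\ldots,d_r$ with $d\ge d_i\ge d/2$ for $i=1,\ldots,r$, $$ \mathcal{A}(d_1,\ldots,d_r) := \left\{ L(\lambda)\begin{bmatrix} 0 & \Delta_r\\ -\Delta_r & 0\end{bmatrix} L(\lambda)^T \; : \; \begin{array}{l} L(\lambda)\in\mathrm{POL}^{m\times 2r},\\ \deg(L_{*i})=d_i \text{ and } \deg(L_{*(2r-i+1)})=d-d_i \text{ for } i=1,\ldots,r\end{array}\right\}. $$ These are subsets of $\mathrm{POL}^{ss}_{d,m}$, the vector space of $m\times m$ skew-symmetric matrix polynomials $P(\lambda)=\sum_{i=0}^d\lambda^iA_i$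 ($A_i^T=-A_i\in\mathbb{C}^{m\times m}$) of degree at most $d$, equipped with the distance $d(P,P')=\left(\sum_{i=0}^d\|A_i-A_i'\|_F^2\right)^{1/2}$, where $P'(\lambda)=\sum_{i=0}^d\lambda^iA_i'$. $\overline{\mathcal{S}}$ denotes closure in $\mathrm{POL}^{ss}_{d,m}$ with the resulting (Euclidean) topology. *)

theory Defs
  imports
    "HOL-Computational_Algebra.Polynomial"
    "HOL-Analysis.L2_Norm"
    "HOL-Analysis.Abstract_Metric_Spaces"
    "Jordan_Normal_Form.Matrix"
begin

text \<open>
  Matrix polynomials are matrices over \<^typ>\<open>complex poly\<close>: \<open>POL\<close> of size \<open>p \<times> q\<close> is
  \<open>carrier_mat p q\<close>. Matrix and vector indices of the matrix library start at 0.
\<close>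

definition coeff_vec :: "nat \<Rightarrow> complex poly vec \<Rightarrow> complex vec" where
  "coeff_vec k v = map_vec (\<lambda>p. coeff p k) v"

text \<open>The degree is given as a relation, so that the zero vector has no degree at all
  (whereas \<^term>\<open>degree 0 = 0\<close> for the polynomials of the library).\<close>

definition has_vec_degree :: "complex poly vec \<Rightarrow> nat \<Rightarrow> bool" where
  "has_vec_degree v k \<longleftrightarrow>
     coeff_vec k v \<noteq> 0\<^sub>v (dim_vec v) \<and> (\<forall>j>k. coeff_vec j v = 0\<^sub>v (dim_vec v))"

text \<open>The size is a parameter in order that the distance below, and hence its symmetry, makes
  sense for arguments of arbitrary dimensions, as the locale \<^locale>\<open>Metric_space\<close> requires.\<close>

definition coeff_mat :: "nat \<Rightarrow> nat \<Rightarrow> complex poly mat \<Rightarrow> complex mat" where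
  "coeff_mat m i P = mat m m (\<lambda>(a, b). coeff (P $$ (a, b)) i)"

definition POL_ss :: "nat \<Rightarrow> nat \<Rightarrow> complex poly mat set" where
  "POL_ss d m = {P \<in> carrier_mat m m.
     (\<forall>i\<le>d. transpose_mat (coeff_mat m i P) = - coeff_mat m i P) \<and>
     (\<forall>i>d. coeff_mat m i P = 0\<^sub>m m m)}"

definition frobenius_norm :: "complex mat \<Rightarrow> real" where
  "frobenius_norm A = sqrt (\<Sum>i<dim_row A. \<Sum>j<dim_col A. (cmod (A $$ (i, j)))\<^sup>2)"

definition POL_dist :: "nat \<Rightarrow> nat \<Rightarrow> complex poly mat \<Rightarrow> complex poly mat \<Rightarrow> real" where
  "POL_dist d m P P' =
     sqrt (\<Sum>i\<le>d. (frobenius_norm (coeff_mat m i P - coeff_mat m i P'))\<^sup>2)"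

definition POL_ss_topology :: "nat \<Rightarrow> nat \<Rightarrow> complex poly mat topology" where
  "POL_ss_topology d m = Metric_space.mtopology (POL_ss d m) (POL_dist d m)"

definition anti_diag_mat :: "nat \<Rightarrow> complex poly mat" where
  "anti_diag_mat r = mat r r (\<lambda>(i, j). if i + j + 1 = r then 1 else 0)"

definition skew_block_mat :: "nat \<Rightarrow> complex poly mat" where
  "skew_block_mat r =
     four_block_mat (0\<^sub>m r r) (anti_diag_mat r) (- anti_diag_mat r) (0\<^sub>m r r)"

text \<open>The degrees \<open>d\<^sub>1, \<dots>, d\<^sub>r\<close> are \<open>ds 1, \<dots>, ds r\<close>, so the \<open>i\<close>-th column \<open>L\<^sub>*\<^sub>i\<close> is
  \<open>col L (i - 1)\<close>, and \<open>col L (2 * r - i)\<close> is the column numbered \<open>2r - i + 1\<close>. The set is meant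
  for \<open>d / 2 \<le> ds i \<le> d\<close>; the natural number \<open>d - ds i\<close> is then not truncated.\<close>

definition A_set :: "nat \<Rightarrow> nat \<Rightarrow> nat \<Rightarrow> (nat \<Rightarrow> nat) \<Rightarrow> complex poly mat set" where
  "A_set m d r ds = {L * skew_block_mat r * transpose_mat L | L.
     L \<in> carrier_mat m (2 * r) \<and>
     (\<forall>i\<in>{1..r}. has_vec_degree (col L (i - 1)) (ds i) \<and>
                 has_vec_degree (col L (2 * r - i)) (d - ds i))}"

lemma frobenius_norm_mat_minus:
  assumes "A \<in> carrier_mat m m" "B \<in> carrier_mat m m"
  shows "frobenius_norm (A - B) =
    L2_set (\<lambda>x. cmod (A $$ x - B $$ x)) ({..<m} \<times> {..<m})"
  using assms by (auto simp: frobenius_norm_def L2_set_def sum.cartesian_product intro!: sum.cong)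

lemma frobenius_norm_triangle:
  assumes "A \<in> carrier_mat m m" "B \<in> carrier_mat m m" "C \<in> carrier_mat m m"
  shows "frobenius_norm (A - C) \<le> frobenius_norm (A - B) + frobenius_norm (B - C)"
proof -
  have "L2_set (\<lambda>x. cmod (A $$ x - C $$ x)) ({..<m} \<times> {..<m})
      \<le> L2_set (\<lambda>x. cmod (A $$ x - B $$ x) + cmod (B $$ x - C $$ x)) ({..<m} \<times> {..<m})"
    by (rule L2_set_mono) (auto, metis dist_complex_def dist_triangle)
  also have "\<dots> \<le> L2_set (\<lambda>x. cmod (A $$ x - B $$ x)) ({..<m} \<times> {..<m})
      + L2_set (\<lambda>x. cmod (B $$ x - C $$ x)) ({..<m} \<times> {..<m})"
    by (rule L2_set_triangle_ineq)
  finally show ?thesis using assms by (simp add: frobenius_norm_mat_minus)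
qed

lemma coeff_mat_carrier [simp]: "coeff_mat m i P \<in> carrier_mat m m"
  by (simp add: coeff_mat_def)

lemma POL_dist_L2_set:
  "POL_dist d m P Q = L2_set (\<lambda>i. frobenius_norm (coeff_mat m i P - coeff_mat m i Q)) {..d}"
  by (simp add: POL_dist_def L2_set_def)

lemma frobenius_norm_nonneg [simp]: "0 \<le> frobenius_norm A"
  by (simp add: frobenius_norm_def sum_nonneg)

lemma Metric_space_POL_ss: "Metric_space (POL_ss d m) (POL_dist d m)"
proof
  fix P Q :: "complex poly mat"
  show "0 \<le> POL_dist d m P Q" by (simp add: POL_dist_L2_set)
  show "POL_dist d m P Q = POL_dist d m Q P"
    by (simp add: POL_dist_L2_set frobenius_norm_mat_minus[of _ m] norm_minus_commute)
next
  fix P Q assume PQ: "P \<in> POL_ss d m" "Q \<in> POL_ss d m"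
  show "POL_dist d m P Q = 0 \<longleftrightarrow> P = Q"
  proof
    assume "POL_dist d m P Q = 0"
    then have *: "\<And>i. i \<le> d \<Longrightarrow> frobenius_norm (coeff_mat m i P - coeff_mat m i Q) = 0"
      by (simp add: POL_dist_L2_set L2_set_eq_0_iff)
    have dims: "P \<in> carrier_mat m m" "Q \<in> carrier_mat m m" using PQ by (auto simp: POL_ss_def)
    have c: "coeff (P $$ (a, b)) i = coeff (Q $$ (a, b)) i" if "a < m" "b < m" for a b i
    proof (cases "i \<le> d")
      case True
      then have "\<forall>x\<in>{..<m} \<times> {..<m}. cmod (coeff_mat m i P $$ x - coeff_mat m i Q $$ x) = 0"
        using *[of i] by (simp add: frobenius_norm_mat_minus[of _ m] L2_set_eq_0_iff)
      with that show ?thesis by (auto simp: coeff_mat_def)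
    next
      case False
      then have "coeff_mat m i P = 0\<^sub>m m m" "coeff_mat m i Q = 0\<^sub>m m m"
        using PQ by (auto simp: POL_ss_def)
      then have "coeff_mat m i P $$ (a, b) = coeff_mat m i Q $$ (a, b)" by simp
      with that show ?thesis by (simp add: coeff_mat_def)
    qed
    show "P = Q"
      using dims by (intro eq_matI) (auto intro!: poly_eqI c)
  next
    assume "P = Q"
    then show "POL_dist d m P Q = 0"
      by (simp add: POL_dist_L2_set frobenius_norm_mat_minus[of _ m] L2_set_eq_0_iff)
  qed
next
  fix P Q R
  have "POL_dist d m P R \<le> L2_set (\<lambda>i. frobenius_norm (coeff_mat m i P - coeff_mat m i Q)
      + frobenius_norm (coeff_mat m i Q - coeff_mat m i R)) {..d}"
    unfolding POL_dist_L2_set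
    by (rule L2_set_mono) (auto intro: frobenius_norm_triangle[where m = m])
  also have "\<dots> \<le> POL_dist d m P Q + POL_dist d m Q R"
    unfolding POL_dist_L2_set by (rule L2_set_triangle_ineq)
  finally show "POL_dist d m P R \<le> POL_dist d m P Q + POL_dist d m Q R" .
qed

lemma topspace_POL_ss_topology: "topspace (POL_ss_topology d m) = POL_ss d m"
  unfolding POL_ss_topology_def by (rule Metric_space.topspace_mtopology[OF Metric_space_POL_ss])

lemma skew_block_mat_carrier [simp]: "skew_block_mat r \<in> carrier_mat (2 * r) (2 * r)"
  unfolding skew_block_mat_def anti_diag_mat_def mult_2
  by (rule four_block_carrier_mat) auto

lemma skew_block_mat_index:
  assumes "k < 2 * r" "l < 2 * r"
  shows "skew_block_mat r $$ (k, l) =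
    (if k + l + 1 = 2 * r then if k < r then 1 else - 1 else 0)"
  using assms unfolding skew_block_mat_def anti_diag_mat_def by auto

lemma A_set_subset_POL_ss:
  assumes ds: "\<And>i. i \<in> {1..r} \<Longrightarrow> ds i \<le> d"
  shows "A_set m d r ds \<subseteq> POL_ss d m"
proof
  fix P assume "P \<in> A_set m d r ds"
  then obtain L where P: "P = L * skew_block_mat r * transpose_mat L"
    and L: "L \<in> carrier_mat m (2 * r)"
    and deg: "\<forall>i\<in>{1..r}. has_vec_degree (col L (i - 1)) (ds i) \<and>
                 has_vec_degree (col L (2 * r - i)) (d - ds i)"
    unfolding A_set_def by blast
  define J where "J = skew_block_mat r"
  have J: "J \<in> carrier_mat (2 * r) (2 * r)" by (simp add: J_def)
  have dimJ [simp]: "dim_row J = 2 * r" "dim_col J = 2 * r" using J by auto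
  have dimL [simp]: "dim_row L = m" "dim_col L = 2 * r" using L by auto
  have Jt: "J $$ (l, k) = - J $$ (k, l)" if "k < 2 * r" "l < 2 * r" for k l
    using that by (auto simp: J_def skew_block_mat_index)
  have entry: "P $$ (a, b) = (\<Sum>l<2*r. \<Sum>k<2*r. L $$ (a, k) * J $$ (k, l) * L $$ (b, l))"
    if "a < m" "b < m" for a b
    using that by (simp add: P J_def[symmetric] scalar_prod_def sum_distrib_right atLeast0LessThan)
  have skew: "P $$ (b, a) = - P $$ (a, b)" if "a < m" "b < m" for a b
  proof -
    have "P $$ (b, a) = (\<Sum>k<2*r. \<Sum>l<2*r. L $$ (b, k) * J $$ (k, l) * L $$ (a, l))"
      using that by (subst sum.swap) (simp add: entry)
    also have "\<dots> = (\<Sum>k<2*r. \<Sum>l<2*r. - (L $$ (a, l) * J $$ (l, k) * L $$ (b, k)))"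
    proof (intro sum.cong refl)
      fix k l assume "k \<in> {..<2*r}" "l \<in> {..<2*r}"
      then have "J $$ (k, l) = - J $$ (l, k)" using Jt[of l k] by simp
      then show "L $$ (b, k) * J $$ (k, l) * L $$ (a, l) = - (L $$ (a, l) * J $$ (l, k) * L $$ (b, k))"
        by (simp only: mult_minus_left mult_minus_right mult_ac)
    qed
    finally show ?thesis using that by (simp add: entry sum_negf)
  qed
  have col_deg: "degree (L $$ (a, k)) \<le> n"
    if "has_vec_degree (col L k) n" "a < m" "k < 2 * r" for a k n
  proof (rule degree_le, intro allI impI)
    fix j assume "n < j"
    with that(1) have "coeff_vec j (col L k) = 0\<^sub>v m"
      by (auto simp: has_vec_degree_def)
    then have "coeff_vec j (col L k) $ a = 0" using that by simp
    then show "coeff (L $$ (a, k)) j = 0" using that by (simp add: coeff_vec_def)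
  qed
  have term_deg: "degree (L $$ (a, k) * J $$ (k, l) * L $$ (b, l)) \<le> d"
    if a: "a < m" and b: "b < m" and k: "k < 2 * r" and l: "l < 2 * r" for a b k l
  proof (cases "k + l + 1 = 2 * r")
    case False
    then show ?thesis using k l by (simp add: J_def skew_block_mat_index)
  next
    case eq: True
    have "degree (L $$ (a, k)) + degree (L $$ (b, l)) \<le> d"
    proof (cases "k < r")
      case True
      have *: "Suc k \<in> {1..r}" "2 * r - Suc k = l" using True eq by auto
      have "degree (L $$ (a, k)) \<le> ds (Suc k)" "degree (L $$ (b, l)) \<le> d - ds (Suc k)"
        using deg[rule_format, OF *(1)] col_deg a b k l *(2) by auto
      then show ?thesis using ds[OF *(1)] by linarith
    next
      case False
      have *: "Suc l \<in> {1..r}" "2 * r - Suc l = k" using False eq by auto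
      have "degree (L $$ (b, l)) \<le> ds (Suc l)" "degree (L $$ (a, k)) \<le> d - ds (Suc l)"
        using deg[rule_format, OF *(1)] col_deg a b k l *(2) by auto
      then show ?thesis using ds[OF *(1)] by linarith
    qed
    moreover have "J $$ (k, l) = 1 \<or> J $$ (k, l) = - 1"
      using k l eq by (auto simp: J_def skew_block_mat_index)
    ultimately show ?thesis
      using degree_mult_le[of "L $$ (a, k)" "L $$ (b, l)"] by auto
  qed
  have coeff0: "coeff (P $$ (a, b)) i = 0" if "a < m" "b < m" "d < i" for a b i
  proof -
    have "degree (P $$ (a, b)) \<le> d"
      unfolding entry[OF that(1,2)] using that term_deg by (intro degree_sum_le) auto
    then show ?thesis using that(3) by (intro coeff_eq_0) simp
  qed
  have Pc: "P \<in> carrier_mat m m" unfolding P by (rule carrier_matI) simp_all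
  have "transpose_mat (coeff_mat m i P) = - coeff_mat m i P" for i
  proof (rule eq_matI)
    fix a b
    assume "a < dim_row (- coeff_mat m i P)" "b < dim_col (- coeff_mat m i P)"
    then have ab: "a < m" "b < m" by (simp_all add: coeff_mat_def)
    show "transpose_mat (coeff_mat m i P) $$ (a, b) = (- coeff_mat m i P) $$ (a, b)"
      using ab skew[OF ab] by (simp add: coeff_mat_def)
  qed (simp_all add: coeff_mat_def)
  moreover have "coeff_mat m i P = 0\<^sub>m m m" if "d < i" for i
    using that by (intro eq_matI) (simp_all add: coeff_mat_def coeff0)
  ultimately show "P \<in> POL_ss d m" using Pc by (simp add: POL_ss_def)
qed

end

theory Submission
  imports Defs
begin

text \<open>
  An element of the set is a sum of \<open>r\<close> terms \<open>u \<and> v = u v\<^sup>T - v u\<^sup>T\<close>, which can be perturbed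
  separately. Let \<open>deg u = a\<close>, \<open>deg v = d - a < n = \<lfloor>d / 2\<rfloor>\<close>, put \<open>k = a - n\<close> and divide with
  remainder: \<open>u = \<lambda>\<^sup>k q + s\<close>, where \<open>deg q = n\<close> and \<open>s\<close> has degree less than \<open>k\<close>. For
  \<open>u' = s - c\<^sup>-\<^sup>1 \<lambda>\<^sup>k v = u - c\<^sup>-\<^sup>1 \<lambda>\<^sup>k v'\<close> and \<open>v' = v + c q\<close> we obtain
  \<open>u' \<and> v' = u \<and> v' = u \<and> v + c (s \<and> q)\<close>, which tends to \<open>u \<and> v\<close> as \<open>c \<rightarrow> 0\<close>, while
  \<open>deg u' = k + d - a = d - n\<close> and \<open>deg v' = n\<close>.
\<close>

lemma poly_shift_cutoff_decomp:
  "monom 1 k * poly_shift k p + poly_cutoff k p = (p :: 'a :: comm_semiring_1 poly)"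
  by (rule poly_eqI) (simp add: coeff_monom_mult coeff_poly_shift coeff_poly_cutoff)

lemma smult_sum_right: "Polynomial.smult c (\<Sum>i\<in>A. f i) = (\<Sum>i\<in>A. Polynomial.smult c (f i))"
  by (induction A rule: infinite_finite_induct) (simp_all add: smult_add_right)

lemma wedge_perturbation:
  fixes ux uy vx vy :: "'a :: field poly"
  assumes "c \<noteq> 0"
  shows "(poly_cutoff k ux - Polynomial.smult (inverse c) (monom 1 k * vx)) * (vy + Polynomial.smult c (poly_shift k uy))
       - (vx + Polynomial.smult c (poly_shift k ux)) * (poly_cutoff k uy - Polynomial.smult (inverse c) (monom 1 k * vy))
     = ux * vy - vx * uy
       + Polynomial.smult c (poly_cutoff k ux * poly_shift k uy - poly_shift k ux * poly_cutoff k uy)"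
proof -
  have inv: "[:inverse c:] * [:c:] = 1" using assms by (simp add: one_pCons)
  have "(sx - C' * (M * vx)) * (vy + C * qy) - (vx + C * qx) * (sy - C' * (M * vy))
      = (M * qx + sx) * vy - vx * (M * qy + sy) + C * (sx * qy - qx * sy)"
    if "C' * C = 1" for sx sy qx qy M C C' :: "'a poly"
  proof -
    have "(sx - C' * (M * vx)) * (vy + C * qy) - (vx + C * qx) * (sy - C' * (M * vy))
      = sx * vy - vx * sy + (C' * C) * (M * (qx * vy - vx * qy)) + C * (sx * qy - qx * sy)"
      by (simp add: algebra_simps)
    with that show ?thesis by (simp add: algebra_simps)
  qed
  from this[OF inv, of "poly_cutoff k ux" "monom 1 k" "poly_shift k uy" "poly_shift k ux" "poly_cutoff k uy"]
  show ?thesis by (simp add: poly_shift_cutoff_decomp)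
qed

lemma has_vec_degree_iff:
  "has_vec_degree v k \<longleftrightarrow>
     (\<exists>x<dim_vec v. coeff (v $ x) k \<noteq> 0) \<and> (\<forall>j>k. \<forall>x<dim_vec v. coeff (v $ x) j = 0)"
  by (auto simp: has_vec_degree_def coeff_vec_def vec_eq_iff)

lemma skew_congruence_index:
  assumes L: "L \<in> carrier_mat m (2 * r)" and xy: "x < m" "y < m"
  shows "(L * skew_block_mat r * transpose_mat L) $$ (x, y) =
    (\<Sum>i<r. L $$ (x, i) * L $$ (y, 2 * r - 1 - i) - L $$ (x, 2 * r - 1 - i) * L $$ (y, i))"
proof -
  define J where "J = skew_block_mat r"
  have [simp]: "dim_row J = 2 * r" "dim_col J = 2 * r"
    unfolding J_def by (rule carrier_matD[OF skew_block_mat_carrier])+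
  have [simp]: "dim_row L = m" "dim_col L = 2 * r" using L by auto
  have row: "(\<Sum>l<2*r. L $$ (x, k) * J $$ (k, l) * L $$ (y, l)) =
      (if k < r then 1 else - 1) * (L $$ (x, k) * L $$ (y, 2 * r - 1 - k))" if "k < 2 * r" for k
  proof -
    have "(\<Sum>l<2*r. L $$ (x, k) * J $$ (k, l) * L $$ (y, l)) =
      (\<Sum>l<2*r. if l = 2 * r - 1 - k
        then (if k < r then 1 else - 1) * (L $$ (x, k) * L $$ (y, l)) else 0)"
      using that by (intro sum.cong refl) (auto simp: J_def skew_block_mat_index)
    then show ?thesis using that by (simp add: sum.delta)
  qed
  have "(L * J * transpose_mat L) $$ (x, y) =
      (\<Sum>l<2*r. \<Sum>k<2*r. L $$ (x, k) * J $$ (k, l) * L $$ (y, l))"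
    using xy by (simp add: scalar_prod_def sum_distrib_right atLeast0LessThan)
  also have "\<dots> = (\<Sum>k<2*r. (if k < r then 1 else - 1) * (L $$ (x, k) * L $$ (y, 2 * r - 1 - k)))"
    by (subst sum.swap) (intro sum.cong refl row, simp)
  also have "\<dots> = (\<Sum>k<r. L $$ (x, k) * L $$ (y, 2 * r - 1 - k))
      + (\<Sum>k\<in>{r..<2*r}. - (L $$ (x, k) * L $$ (y, 2 * r - 1 - k)))"
  proof -
    have "{..<2*r} = {..<r} \<union> {r..<2*r}" by auto
    then show ?thesis by (simp add: sum.union_disjoint ivl_disj_int)
  qed
  also have "(\<Sum>k\<in>{r..<2*r}. - (L $$ (x, k) * L $$ (y, 2 * r - 1 - k)))
      = (\<Sum>i<r. - (L $$ (x, 2 * r - 1 - i) * L $$ (y, i)))"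
    by (rule sum.reindex_bij_witness[where i = "\<lambda>i. 2 * r - 1 - i" and j = "\<lambda>k. 2 * r - 1 - k"]) auto
  finally show ?thesis by (simp add: J_def sum.distrib sum_negf sum_subtractf)
qed

lemma POL_dist_add_smult:
  assumes "P \<in> carrier_mat m m" "E \<in> carrier_mat m m" "Q \<in> carrier_mat m m"
    and Q: "\<And>x y. x < m \<Longrightarrow> y < m \<Longrightarrow> Q $$ (x, y) = P $$ (x, y) + Polynomial.smult c (E $$ (x, y))"
  shows "POL_dist d m P Q = cmod c * POL_dist d m E (0\<^sub>m m m)"
proof -
  have "frobenius_norm (coeff_mat m i P - coeff_mat m i Q)
      = cmod c * frobenius_norm (coeff_mat m i E - coeff_mat m i (0\<^sub>m m m))" for i
    by (auto simp: frobenius_norm_mat_minus[of _ m] L2_set_right_distrib coeff_mat_def Q norm_mult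
        intro!: L2_set_cong)
  then show ?thesis by (simp add: POL_dist_L2_set L2_set_right_distrib)
qed

lemma A_set_perturbation:
  assumes P: "P \<in> A_set m d r ds"
    and ds: "\<And>i. i \<in> {1..r} \<Longrightarrow> ds i \<le> d \<and> d - ds i \<le> n"
    and n: "n \<le> d - n"
  shows "\<exists>E \<in> carrier_mat m m. \<forall>c. c \<noteq> 0 \<longrightarrow>
    (\<exists>Q \<in> A_set m d r (\<lambda>_. d - n). \<forall>x<m. \<forall>y<m. Q $$ (x, y) = P $$ (x, y) + Polynomial.smult c (E $$ (x, y)))"
proof -
  from P obtain L where P: "P = L * skew_block_mat r * transpose_mat L"
    and L: "L \<in> carrier_mat m (2 * r)"
    and deg: "\<forall>i\<in>{1..r}. has_vec_degree (col L (i - 1)) (ds i) \<and>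
                 has_vec_degree (col L (2 * r - i)) (d - ds i)"
    unfolding A_set_def by blast
  have [simp]: "dim_row L = m" "dim_col L = 2 * r" using L by auto
  define k where "k i = ds (Suc i) - n" for i
  define B where "B i \<longleftrightarrow> d - ds (Suc i) < n" for i
  define U where "U x i = L $$ (x, i)" for x i
  define V where "V x i = L $$ (x, 2 * r - 1 - i)" for x i
  define E where "E = mat m m (\<lambda>(x, y). \<Sum>i<r. if B i
     then poly_cutoff (k i) (U x i) * poly_shift (k i) (U y i)
          - poly_shift (k i) (U x i) * poly_cutoff (k i) (U y i) else 0)"
  have degU: "\<exists>x<m. coeff (U x i) (ds (Suc i)) \<noteq> 0"
      "\<And>j x. ds (Suc i) < j \<Longrightarrow> x < m \<Longrightarrow> coeff (U x i) j = 0"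
    and degV: "\<exists>x<m. coeff (V x i) (d - ds (Suc i)) \<noteq> 0"
      "\<And>j x. d - ds (Suc i) < j \<Longrightarrow> x < m \<Longrightarrow> coeff (V x i) j = 0" if "i < r" for i
    using deg[rule_format, of "Suc i"] that by (auto simp: has_vec_degree_iff U_def V_def)
  show ?thesis
  proof (rule bexI[of _ E], rule allI, rule impI)
    show "E \<in> carrier_mat m m" by (simp add: E_def)
  next
    fix c :: complex assume c: "c \<noteq> 0"
    define U' where "U' x i = (if B i
      then poly_cutoff (k i) (U x i) - Polynomial.smult (inverse c) (monom 1 (k i) * V x i) else U x i)" for x i
    define V' where "V' x i = (if B i then V x i + Polynomial.smult c (poly_shift (k i) (U x i)) else V x i)"
      for x i
    define L' where "L' = mat m (2 * r) (\<lambda>(x, j). if j < r then U' x j else V' x (2 * r - 1 - j))"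
    define Q where "Q = L' * skew_block_mat r * transpose_mat L'"
    have L': "L' \<in> carrier_mat m (2 * r)" by (simp add: L'_def)
    have degU': "(\<exists>x<m. coeff (U' x i) (d - n) \<noteq> 0) \<and> (\<forall>j>d - n. \<forall>x<m. coeff (U' x i) j = 0)"
      and degV': "(\<exists>x<m. coeff (V' x i) n \<noteq> 0) \<and> (\<forall>j>n. \<forall>x<m. coeff (V' x i) j = 0)"
      if i: "i < r" for i
    proof -
      have dsi: "ds (Suc i) \<le> d" "d - ds (Suc i) \<le> n" using ds[of "Suc i"] i by auto
      have "((\<exists>x<m. coeff (U' x i) (d - n) \<noteq> 0) \<and> (\<forall>j>d - n. \<forall>x<m. coeff (U' x i) j = 0)) \<and>
        (\<exists>x<m. coeff (V' x i) n \<noteq> 0) \<and> (\<forall>j>n. \<forall>x<m. coeff (V' x i) j = 0)"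
      proof (cases "B i")
        case True
        then have b: "d - ds (Suc i) < n" by (simp add: B_def)
        have k: "k i + (d - ds (Suc i)) = d - n" "k i + n = ds (Suc i)"
          using b dsi n by (auto simp: k_def)
        obtain x where x: "x < m" "coeff (V x i) (d - ds (Suc i)) \<noteq> 0" using degV[OF i] by auto
        obtain y where y: "y < m" "coeff (U y i) (ds (Suc i)) \<noteq> 0" using degU[OF i] by auto
        have "d - n - k i = d - ds (Suc i)" "k i \<le> d - n" using k by linarith+
        then have "coeff (U' x i) (d - n) \<noteq> 0"
          using x c True by (simp add: U'_def coeff_poly_cutoff coeff_monom_mult)
        moreover have "coeff (U' z i) j = 0" if "d - n < j" "z < m" for z j
        proof -
          have "k i < j" "d - ds (Suc i) < j - k i" using k that by linarith+
          then show ?thesis using that True degV(2)[OF i]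
            by (simp add: U'_def coeff_poly_cutoff coeff_monom_mult)
        qed
        moreover have "coeff (V' y i) n \<noteq> 0"
          using y c True b k degV(2)[OF i] by (simp add: V'_def coeff_poly_shift add.commute)
        moreover have "coeff (V' z i) j = 0" if "n < j" "z < m" for z j
          using that True b k degV(2)[OF i] degU(2)[OF i] by (simp add: V'_def coeff_poly_shift)
        ultimately show ?thesis using x y by blast
      next
        case False
        then have "ds (Suc i) = d - n" "d - ds (Suc i) = n" using dsi by (auto simp: B_def)
        with degU[OF i] degV[OF i] False show ?thesis by (simp add: U'_def V'_def)
      qed
      then show "(\<exists>x<m. coeff (U' x i) (d - n) \<noteq> 0) \<and> (\<forall>j>d - n. \<forall>x<m. coeff (U' x i) j = 0)"
        "(\<exists>x<m. coeff (V' x i) n \<noteq> 0) \<and> (\<forall>j>n. \<forall>x<m. coeff (V' x i) j = 0)" by blast+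
    qed
    have L'U: "L' $$ (x, i) = U' x i" and L'V: "L' $$ (x, 2 * r - Suc i) = V' x i"
      if "x < m" "i < r" for x i
      using that by (auto simp: L'_def)
    have "has_vec_degree (col L' (i - 1)) (d - n) \<and> has_vec_degree (col L' (2 * r - i)) (d - (d - n))"
      if "i \<in> {1..r}" for i
    proof -
      from that obtain i' where i': "i = Suc i'" "i' < r" by (cases i) auto
      have "d - (d - n) = n" using n by linarith
      then show ?thesis
        using degU'[OF i'(2)] degV'[OF i'(2)] L' i' by (auto simp: has_vec_degree_iff L'U L'V)
    qed
    with L' have "Q \<in> A_set m d r (\<lambda>_. d - n)" unfolding A_set_def Q_def by blast
    moreover have "Q $$ (x, y) = P $$ (x, y) + Polynomial.smult c (E $$ (x, y))" if xy: "x < m" "y < m" for x y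
    proof -
      have "Q $$ (x, y) = (\<Sum>i<r. U' x i * V' y i - V' x i * U' y i)"
        unfolding Q_def skew_congruence_index[OF L' xy] using xy by (simp add: L'U L'V)
      also have "\<dots> = (\<Sum>i<r. (U x i * V y i - V x i * U y i) + Polynomial.smult c (if B i
          then poly_cutoff (k i) (U x i) * poly_shift (k i) (U y i)
            - poly_shift (k i) (U x i) * poly_cutoff (k i) (U y i) else 0))"
        by (rule sum.cong[OF refl]) (simp add: U'_def V'_def wedge_perturbation[OF c])
      also have "\<dots> = P $$ (x, y) + Polynomial.smult c (E $$ (x, y))"
        unfolding P skew_congruence_index[OF L xy] using xy
        by (simp add: sum.distrib E_def U_def V_def smult_sum_right)
      finally show ?thesis .
    qed
    ultimately show "\<exists>Q \<in> A_set m d r (\<lambda>_. d - n).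
        \<forall>x<m. \<forall>y<m. Q $$ (x, y) = P $$ (x, y) + Polynomial.smult c (E $$ (x, y))" by blast
  qed
qed

theorem theorem3p7:
  fixes m r d :: nat and ds :: "nat \<Rightarrow> nat"
  assumes "1 \<le> d"
    and "2 \<le> 2 * r" and "2 * r \<le> m - 1"
    and "\<And>i. i \<in> {1..r} \<Longrightarrow> ds i \<le> d \<and> real d / 2 \<le> real (ds i)"
  shows "A_set m d r ds
    \<subseteq> POL_ss_topology d m closure_of A_set m d r (\<lambda>i. nat \<lceil>real d / 2\<rceil>)"
proof
  fix P assume P: "P \<in> A_set m d r ds"
  interpret Metric_space "POL_ss d m" "POL_dist d m" by (rule Metric_space_POL_ss)
  define n where "n = d div 2"
  have ceil: "nat \<lceil>real d / 2\<rceil> = d - n"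
  proof -
    have "\<lceil>real d / 2\<rceil> = int (d - n)"
      by (rule ceiling_unique) (auto simp: n_def of_nat_diff field_simps)
    then show ?thesis by simp
  qed
  have ds: "ds i \<le> d \<and> d - ds i \<le> n" if "i \<in> {1..r}" for i
    using assms(4)[OF that] unfolding n_def by linarith
  have n: "n \<le> d - n" by (simp add: n_def)
  obtain E where E: "E \<in> carrier_mat m m"
    and EQ: "\<And>c. c \<noteq> 0 \<Longrightarrow> \<exists>Q \<in> A_set m d r (\<lambda>_. d - n).
      \<forall>x<m. \<forall>y<m. Q $$ (x, y) = P $$ (x, y) + Polynomial.smult c (E $$ (x, y))"
    using A_set_perturbation[OF P ds n] by blast
  have PM: "P \<in> POL_ss d m" using A_set_subset_POL_ss[of r ds d m] ds P by blast
  have AM: "A_set m d r (\<lambda>_. d - n) \<subseteq> POL_ss d m" by (rule A_set_subset_POL_ss) simp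
  have "\<exists>Q \<in> A_set m d r (\<lambda>_. d - n). Q \<in> mball P e" if e: "e > 0" for e
  proof -
    define D where "D = POL_dist d m E (0\<^sub>m m m)"
    have D: "D \<ge> 0" by (simp add: D_def)
    define t where "t = e / (1 + D)"
    have t: "t > 0" "t * D < e" using e D by (auto simp: t_def field_simps)
    obtain Q where Q: "Q \<in> A_set m d r (\<lambda>_. d - n)"
      "\<And>x y. x < m \<Longrightarrow> y < m \<Longrightarrow> Q $$ (x, y) = P $$ (x, y) + Polynomial.smult (of_real t) (E $$ (x, y))"
      using EQ[of "of_real t"] t by auto
    have QM: "Q \<in> POL_ss d m" using Q AM by blast
    have "POL_dist d m P Q = cmod (of_real t) * D"
      unfolding D_def using PM QM E Q(2) by (intro POL_dist_add_smult) (auto simp: POL_ss_def)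
    with t have "POL_dist d m P Q < e" by simp
    with Q PM QM show ?thesis by (auto simp: in_mball)
  qed
  then show "P \<in> POL_ss_topology d m closure_of A_set m d r (\<lambda>i. nat \<lceil>real d / 2\<rceil>)"
    using PM unfolding ceil POL_ss_topology_def metric_closure_of by auto
qed

end
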